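(* Let $G$ be a finite simple graph on $n$ vertices with maximum degree $\Delta(G)$. If $\Delta(G)\geq 3$, then $\operatorname{dmg}(G; 2) \leq n-3$.
   Context: All graphs are finite, undirected and simple, and need not be connected. The game with one cop and $s$ robbers on a graph $G$ is a perfect-information game. In round $0$ the cop chooses an initial vertex, and then each robber chooses an initial vertex (several robbers may share a vertex). Each subsequent round consists of a turn for the cop followed by a turn for the robbers; on their turn, each player may stay put or move to a neighboring vertex (on the robbers' turn every uncaptured robber may do so). Whenever the cop occupies the same vertex as one or more robbers, all those robbers are captured and take no further part in the game. If a robber occupies a vertex $v$ at the end of some round (including round $0$) and that robber is not captured in the following round, then $v$ becomes damaged (and stays damaged). The robbers aim to maximize, and the cop aims to minimize, the total number of damaged vertices. The $s$-robber damage number $\operatorname{dmg}(G;s)$ is the number of vertices damaged under optimal play, i.e. the smallest $d$ such that the cop has a strategy guaranteeing that at most $d$ vertices are ever damaged, whatever the $s$ robbers do. *)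

theory Defs
  imports "Graph_Theory.Pair_Digraph"
begin

text \<open>
  A finite simple graph is a \<^locale>\<open>pair_graph\<close>: a finite, symmetric, loop-free set of
  ordered pairs. Since an edge \<open>uv\<close> is represented by the two arcs \<open>(u, v)\<close> and \<open>(v, u)\<close>, the
  degree of a vertex is its out-degree.
\<close>

text \<open>The graph without vertices gets maximum degree 0; this is why 0 is inserted under \<open>Max\<close>.\<close>

definition max_degree :: "'a pair_pre_digraph \<Rightarrow> nat" where
  "max_degree G = Max (insert 0 (out_degree (with_proj G) ` pverts G))"

definition can_move :: "'a pair_pre_digraph \<Rightarrow> 'a \<Rightarrow> 'a \<Rightarrow> bool" where
  "can_move G u v \<longleftrightarrow> u \<in> pverts G \<and> (v = u \<or> (u, v) \<in> parcs G)"

text \<open>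
  A configuration lists, for each robber, its vertex at the end of a round, or \<^const>\<open>None\<close>
  if it has been captured. A cop strategy maps the list of the configurations at the end
  of all completed rounds to the vertex of the cop in the next round; on \<open>[]\<close> it gives the initial
  vertex. The strategy is deterministic, so the cop's own earlier positions need not be recorded,
  and a robber that stepped onto the cop is recorded as captured.
\<close>

type_synonym 'a config = "'a option list"

type_synonym 'a cop_strategy = "'a config list \<Rightarrow> 'a"

text \<open>In the next two definitions, \<open>c\<close> is the vertex of the cop during the robbers' turn.\<close>

definition robber_start :: "'a pair_pre_digraph \<Rightarrow> 'a \<Rightarrow> 'a option \<Rightarrow> bool" where
  "robber_start G c x \<longleftrightarrow> (\<exists>v\<in>pverts G. x = (if v = c then None else Some v))"

definition robber_turn ::
    "'a pair_pre_digraph \<Rightarrow> 'a \<Rightarrow> 'a option \<Rightarrow> 'a option \<Rightarrow> bool" where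
  "robber_turn G c x y \<longleftrightarrow>
     (case x of
        None \<Rightarrow> y = None
      | Some v \<Rightarrow>
          if v = c then y = None
          else (\<exists>w. can_move G v w \<and> y = (if w = c then None else Some w)))"

definition cop_pos :: "'a cop_strategy \<Rightarrow> (nat \<Rightarrow> 'a config) \<Rightarrow> nat \<Rightarrow> 'a" where
  "cop_pos \<sigma> r t = \<sigma> (map r [0..<t])"

text \<open>\<open>r t\<close> is the configuration at the end of round \<open>t\<close>.\<close>

definition robbers_play ::
    "'a pair_pre_digraph \<Rightarrow> nat \<Rightarrow> 'a cop_strategy \<Rightarrow> (nat \<Rightarrow> 'a config) \<Rightarrow> bool" where
  "robbers_play G s \<sigma> r \<longleftrightarrow>
     length (r 0) = s \<and>
     (\<forall>x\<in>set (r 0). robber_start G (cop_pos \<sigma> r 0) x) \<and>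
     (\<forall>t. list_all2 (robber_turn G (cop_pos \<sigma> r (Suc t))) (r t) (r (Suc t)))"

definition legal_cop_strategy :: "'a pair_pre_digraph \<Rightarrow> nat \<Rightarrow> 'a cop_strategy \<Rightarrow> bool" where
  "legal_cop_strategy G s \<sigma> \<longleftrightarrow>
     \<sigma> [] \<in> pverts G \<and>
     (\<forall>r. robbers_play G s \<sigma> r \<longrightarrow>
        (\<forall>t. can_move G (cop_pos \<sigma> r t) (cop_pos \<sigma> r (Suc t))))"

definition damaged :: "nat \<Rightarrow> (nat \<Rightarrow> 'a config) \<Rightarrow> 'a set" where
  "damaged s r = {v. \<exists>t. \<exists>i<s. r t ! i = Some v \<and> r (Suc t) ! i \<noteq> None}"

definition dmg :: "'a pair_pre_digraph \<Rightarrow> nat \<Rightarrow> nat" where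
  "dmg G s =
     (LEAST d. \<exists>\<sigma>. legal_cop_strategy G s \<sigma> \<and>
        (\<forall>r. robbers_play G s \<sigma> r \<longrightarrow> card (damaged s r) \<le> d))"

end

theory Submission
  imports Defs
begin

text \<open>
  Fix a vertex \<open>v\<close> with three neighbours \<open>Q\<close>; the cop, who never leaves \<open>insert v Q\<close>, loses at most
  one of these four vertices. He waits at \<open>v\<close> until robbers enter \<open>Q\<close> and then captures one of them.
  If the other robber is at \<open>w \<in> Q\<close> at that moment, then \<open>w\<close> is lost, and the only danger is that this
  robber goes on to the third vertex \<open>x\<close> of \<open>Q\<close>. But if the robbers are at \<open>u\<close> and \<open>w\<close>, the cop can
  choose whom to capture so that the survivor either is not adjacent to \<open>x\<close> or can be captured on
  \<open>x\<close> at once. Otherwise the cop returns to \<open>v\<close>, from where he protects \<open>insert v Q\<close> against a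
  single robber.
\<close>

text \<open>The maximum might be the inserted 0; \<open>0 < k\<close> excludes this, so it is the
  degree of a vertex.\<close>

lemma max_degree_attained:
  assumes "finite (pverts G)" and "0 < k" and "k \<le> max_degree G"
  obtains v where "v \<in> pverts G" and "k \<le> out_degree (with_proj G) v"
proof -
  have "max_degree G \<in> insert 0 (out_degree (with_proj G) ` pverts G)"
    unfolding max_degree_def using assms(1) by (intro Max_in) auto
  with assms that show thesis by auto
qed

lemma out_degree_with_proj:
  "out_degree (with_proj G) v = card {w. (v, w) \<in> parcs G}"
proof -
  have "out_arcs (with_proj G) v = Pair v ` {w. (v, w) \<in> parcs G}"
    by (auto simp: out_arcs_def)
  then show ?thesis
    by (simp add: out_degree_def card_image inj_on_def)
qed

section \<open>The cop's strategy on a star with three leaves\<close>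

locale guarded_star = pair_graph G for G :: "'a pair_pre_digraph" +
  fixes v :: 'a and Q :: "'a set"
  assumes center: "v \<in> pverts G"
    and leaves: "\<And>w. w \<in> Q \<Longrightarrow> (v, w) \<in> parcs G"
    and card_leaves: "card Q = 3"
begin

lemma center_notin_leaves: "v \<notin> Q"
  using leaves no_loops by fastforce

lemma leaf_center: "w \<in> Q \<Longrightarrow> (w, v) \<in> parcs G"
  using leaves arcs_symmetric by blast

lemma star_subset: "insert v Q \<subseteq> pverts G"
  using center leaves wellformed by (metis insert_subset snd_conv subsetI in_arcsD2)

definition threatened :: "'a config \<Rightarrow> 'a set" where
  "threatened C = {y \<in> Q. Some y \<in> set C}"

text \<open>Here \<open>w\<close> stands for the leaf of the robber that survives the capture on
  \<open>y\<close>, and \<open>x\<close> for a leaf it may enter next: the cop on \<open>y\<close>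
  must be able to answer that move at once.\<close>

definition good_target :: "'a set \<Rightarrow> 'a \<Rightarrow> bool" where
  "good_target S y \<longleftrightarrow>
     y \<in> S \<and> (\<forall>w\<in>S - {y}. \<forall>x\<in>Q - {y, w}. (w, x) \<in> parcs G \<longrightarrow> (y, x) \<in> parcs G)"

definition cop_step :: "'a \<Rightarrow> 'a config \<Rightarrow> 'a" where
  "cop_step c C =
     (if c = v then
        if threatened C = {} then v else SOME y. good_target (threatened C) y
      else if \<exists>y\<in>insert v Q. Some y \<in> set C \<and> (c, y) \<in> parcs G
        then SOME y. y \<in> insert v Q \<and> Some y \<in> set C \<and> (c, y) \<in> parcs G
      else v)"

text \<open>A strategy sees only the configurations of the robbers; the fold replays
  \<open>cop_step\<close> from \<open>v\<close> to recover where the cop stands.\<close>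

definition guard :: "'a cop_strategy" where
  "guard = foldl cop_step v"

text \<open>Two robbers threaten at most two leaves \<open>u\<close> and \<open>w\<close>. If they
  threaten both, a single leaf \<open>x\<close> remains, and the conditions for \<open>u\<close> and
  for \<open>w\<close> are converse implications, so they cannot both fail.\<close>

lemma good_target_exists:
  assumes "length C = 2" and "threatened C \<noteq> {}"
  shows "\<exists>y. good_target (threatened C) y"
proof -
  obtain p q where C: "C = [p, q]"
    using assms(1) by (auto simp: length_Suc_conv numeral_2_eq_2)
  obtain u where u: "u \<in> threatened C"
    using assms(2) by blast
  show ?thesis
  proof (cases "threatened C = {u}")
    case True
    then show ?thesis by (auto simp: good_target_def)
  next
    case False
    then obtain w where w: "w \<in> threatened C" "w \<noteq> u"
      using u by blast
    then have S: "threatened C = {u, w}"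
      using u by (auto simp: threatened_def C)
    have "card (Q - {u, w}) = 1"
      using u w card_leaves by (subst card_Diff_subset) (auto simp: threatened_def)
    then obtain x where x: "Q - {u, w} = {x}"
      by (auto simp: card_1_singleton_iff)
    moreover have "Q - {w, u} = {x}"
      using x by auto
    ultimately show ?thesis
      using w(2) unfolding S good_target_def
      by (cases "(w, x) \<in> parcs G \<longrightarrow> (u, x) \<in> parcs G") auto
  qed
qed

lemma cop_step_waits:
  "threatened C = {} \<Longrightarrow> cop_step v C = v"
  by (simp add: cop_step_def)

lemma cop_step_attacks:
  assumes "length C = 2" and "threatened C \<noteq> {}"
  shows "good_target (threatened C) (cop_step v C)"
  using someI_ex[OF good_target_exists[OF assms]] assms(2) by (simp add: cop_step_def)

lemma cop_step_chases:
  assumes "c \<noteq> v" and "y \<in> insert v Q" and "Some y \<in> set C" and "(c, y) \<in> parcs G"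
  shows "cop_step c C \<in> insert v Q" "Some (cop_step c C) \<in> set C" "(c, cop_step c C) \<in> parcs G"
proof -
  let ?P = "\<lambda>y. y \<in> insert v Q \<and> Some y \<in> set C \<and> (c, y) \<in> parcs G"
  have "\<exists>y. ?P y" and "cop_step c C = (SOME y. ?P y)"
    using assms by (auto simp: cop_step_def)
  then have "?P (cop_step c C)"
    using someI_ex[of ?P] by simp
  then show "cop_step c C \<in> insert v Q" "Some (cop_step c C) \<in> set C"
      "(c, cop_step c C) \<in> parcs G"
    by auto
qed

lemma cop_step_returns:
  assumes "c \<noteq> v" and "\<And>y. y \<in> insert v Q \<Longrightarrow> Some y \<in> set C \<Longrightarrow> (c, y) \<notin> parcs G"
  shows "cop_step c C = v"
  using assms by (auto simp: cop_step_def)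

lemma cop_step_legal:
  assumes "length C = 2" and "c \<in> insert v Q"
  shows "cop_step c C \<in> insert v Q" and "can_move G c (cop_step c C)"
proof -
  have "cop_step c C \<in> insert v Q \<and> (cop_step c C = c \<or> (c, cop_step c C) \<in> parcs G)"
  proof (cases "c = v")
    case True
    show ?thesis
    proof (cases "threatened C = {}")
      case False
      then have "cop_step v C \<in> Q"
        using cop_step_attacks[OF assms(1)] by (auto simp: good_target_def threatened_def)
      with True leaves show ?thesis by simp
    qed (simp add: True cop_step_waits)
  next
    case False
    \<comment> \<open>Off the center the cop is on a leaf, so the way back to \<open>v\<close> is
      always open.\<close>
    then have "(c, v) \<in> parcs G"
      using assms(2) leaf_center by simp
    with False cop_step_chases[OF False] cop_step_returns[OF False] show ?thesis
      by (metis insertI1)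
  qed
  then show "cop_step c C \<in> insert v Q" and "can_move G c (cop_step c C)"
    using assms(2) star_subset by (auto simp: can_move_def)
qed

lemma cop_pos_guard_0: "cop_pos guard r 0 = v"
  by (simp add: cop_pos_def guard_def)

lemma cop_pos_guard_Suc: "cop_pos guard r (Suc t) = cop_step (cop_pos guard r t) (r t)"
  by (simp add: cop_pos_def guard_def)

end

section \<open>Plays against the strategy and the damage inside the star\<close>

locale guarded_star_play = guarded_star G v Q
  for G :: "'a pair_pre_digraph" and v :: 'a and Q :: "'a set" +
  fixes r :: "nat \<Rightarrow> 'a config"
  assumes play: "robbers_play G 2 guard r"
begin

abbreviation cop :: "nat \<Rightarrow> 'a" where
  "cop \<equiv> cop_pos guard r"

lemma length_config: "length (r t) = 2"
proof (induction t)
  case 0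
  then show ?case using play by (simp add: robbers_play_def)
next
  case (Suc t)
  then show ?case using play by (metis list_all2_lengthD robbers_play_def)
qed

lemma in_config_iff: "Some y \<in> set (r t) \<longleftrightarrow> (\<exists>i<2. r t ! i = Some y)"
  by (metis in_set_conv_nth length_config)

lemma turn: "i < 2 \<Longrightarrow> robber_turn G (cop (Suc t)) (r t ! i) (r (Suc t) ! i)"
  using play length_config by (auto simp: robbers_play_def list_all2_conv_all_nth)

lemma survivor:
  assumes "i < 2" and "r (Suc t) ! i = Some y"
  obtains w where "r t ! i = Some w" and "w \<noteq> cop (Suc t)" and "can_move G w y"
    and "y \<noteq> cop (Suc t)"
  using turn[OF assms(1), of t] assms(2) that
  by (auto simp: robber_turn_def split: option.splits if_splits)

lemma captured:
  assumes "i < 2" and "r t ! i = Some (cop (Suc t))"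
  shows "r (Suc t) ! i = None"
  using turn[OF assms(1), of t] assms(2) by (simp add: robber_turn_def)

lemma start:
  assumes "i < 2"
  shows "robber_start G v (r 0 ! i)"
proof -
  have "r 0 ! i \<in> set (r 0)"
    using assms by (simp add: length_config)
  then show ?thesis
    using play by (simp add: robbers_play_def cop_pos_guard_0)
qed

text \<open>A robber that starts on or steps onto the cop is recorded as \<open>None\<close>. In
  particular, no robber is on \<open>v\<close> while the cop waits there.\<close>

lemma robber_apart_from_cop:
  assumes "i < 2"
  shows "r t ! i \<noteq> Some (cop t)"
proof (cases t)
  case 0
  then show ?thesis
    using start[OF assms] by (auto simp: robber_start_def cop_pos_guard_0 split: if_splits)
next
  case (Suc t')
  then show ?thesis
    using survivor[OF assms, of t'] by metis
qed

lemma robber_in_verts: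
  assumes "i < 2" and "r t ! i = Some y"
  shows "y \<in> pverts G"
proof (cases t)
  case 0
  then show ?thesis
    using start[OF assms(1)] assms(2) by (auto simp: robber_start_def split: if_splits)
next
  case (Suc t')
  then show ?thesis
    using survivor[OF assms(1), of t' y] assms(2) in_arcsD2 by (metis can_move_def)
qed

text \<open>Whether a position of round \<open>t'\<close> becomes damaged is settled only in round
  \<open>Suc t'\<close>; hence \<open>t' < t\<close> gives the damage to the star that is decided by
  the end of round \<open>t\<close>.\<close>

definition lost :: "nat \<Rightarrow> 'a set" where
  "lost t = {y \<in> insert v Q. \<exists>t'<t. \<exists>i<2. r t' ! i = Some y \<and> r (Suc t') ! i \<noteq> None}"

lemma lost_0: "lost 0 = {}"
  by (simp add: lost_def)

lemma lost_Suc: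
  "lost (Suc t) =
     lost t \<union> {y \<in> insert v Q. \<exists>i<2. r t ! i = Some y \<and> r (Suc t) ! i \<noteq> None}"
  by (auto simp: lost_def less_Suc_eq)

lemma lost_mono: "t \<le> t' \<Longrightarrow> lost t \<subseteq> lost t'"
  unfolding lost_def by (blast intro: less_le_trans)

text \<open>The index \<open>1 - i\<close> is that of the other robber, and \<open>w\<close> is the
  one star vertex that may be given up. Off the center, the cop must be able either to capture
  robber \<open>i\<close> at once or to afford the round needed to return to
  \<open>v\<close>.\<close>

definition contained :: "nat \<Rightarrow> bool" where
  "contained t \<longleftrightarrow>
     (\<exists>i<2. \<exists>w. lost t \<subseteq> {w} \<and> r t ! (1 - i) = None \<and>
        (cop t = v \<or>
         (\<forall>y. r t ! i = Some y \<longrightarrow>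
            y \<in> insert v Q \<and> (cop t, y) \<in> parcs G \<or> insert y (lost t) \<inter> insert v Q \<subseteq> {w})))"

text \<open>The delicate transition is the first capture, where the choice of a good target pays
  off. Afterwards a cop on \<open>v\<close> meets any entry into a leaf by capturing the last
  robber.\<close>

lemma invariant:
  "cop t \<in> insert v Q \<and> (cop t = v \<and> lost t = {} \<or> contained t)"
proof (induction t)
  case 0
  then show ?case by (simp add: cop_pos_guard_0 lost_0)
next
  case (Suc t)
  let ?c = "cop t" and ?c' = "cop (Suc t)"
  have c': "?c' = cop_step ?c (r t)"
    by (rule cop_pos_guard_Suc)
  have in_star: "?c' \<in> insert v Q"
    unfolding c' using Suc length_config cop_step_legal(1) by blast
  have waits: "?c' = v \<and> lost (Suc t) = lost t" if "?c = v" and "threatened (r t) = {}"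
    using that robber_apart_from_cop[of _ t]
    by (auto simp: c' cop_step_waits lost_Suc threatened_def in_config_iff)
  have attacks: "good_target (threatened (r t)) ?c'" if "?c = v" and "threatened (r t) \<noteq> {}"
    using that cop_step_attacks[OF length_config] by (simp add: c')
  consider (open_play) "?c = v" "lost t = {}" | (contained) "contained t"
    using Suc by blast
  then have "?c' = v \<and> lost (Suc t) = {} \<or> contained (Suc t)"
  proof cases
    case open_play
    show ?thesis
    proof (cases "threatened (r t) = {}")
      case True
      with waits open_play show ?thesis by simp
    next
      case False
      note good = attacks[OF open_play(1) False]
      then have "?c' \<in> Q" and "Some ?c' \<in> set (r t)"
        by (auto simp: good_target_def threatened_def)
      then obtain j where j: "j < 2" "r t ! j = Some ?c'"
        by (auto simp: in_config_iff)
      define i where "i = 1 - j"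
      have i: "i < 2" "1 - i = j" and ij: "\<And>k. k < 2 \<Longrightarrow> k = i \<or> k = j"
        using j(1) by (auto simp: i_def)
      have gone: "r (Suc t) ! j = None"
        using captured j by blast
      \<comment> \<open>Robber \<open>j\<close> is captured before its leaf is damaged, so only the
        position of robber \<open>i\<close> can count.\<close>
      have new_lost: "lost (Suc t) = {y \<in> insert v Q. r t ! i = Some y \<and> r (Suc t) ! i \<noteq> None}"
      proof -
        have "(\<exists>k<2. r t ! k = Some y \<and> r (Suc t) ! k \<noteq> None) \<longleftrightarrow>
            r t ! i = Some y \<and> r (Suc t) ! i \<noteq> None" for y
        proof
          assume "\<exists>k<2. r t ! k = Some y \<and> r (Suc t) ! k \<noteq> None"
          then obtain k where k: "k < 2" "r t ! k = Some y" "r (Suc t) ! k \<noteq> None"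
            by blast
          then have "k = i"
            using ij[of k] gone by auto
          with k show "r t ! i = Some y \<and> r (Suc t) ! i \<noteq> None"
            by simp
        qed (use i(1) in blast)
        then show ?thesis
          by (simp add: lost_Suc open_play(2))
      qed
      show ?thesis
      proof (cases "r (Suc t) ! i")
        case None
        with i gone new_lost show ?thesis
          by (auto simp: contained_def intro!: exI[of _ i])
      next
        case (Some y)
        obtain w where w: "r t ! i = Some w" "w \<noteq> ?c'" "can_move G w y" "y \<noteq> ?c'"
          using survivor[OF i(1) Some] .
        \<comment> \<open>If \<open>w\<close> is a leaf, it has just been lost, and the good target
          lets the cop answer a move to another leaf. Otherwise nothing is lost yet, and
          \<open>y\<close> itself may be given up.\<close>
        have safe: "y \<in> insert v Q \<and> (?c', y) \<in> parcs G \<or>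
            insert y (lost (Suc t)) \<inter> insert v Q \<subseteq> {z}" if z: "z = (if w \<in> Q then w else y)" for z
        proof (cases "w \<in> Q")
          case True
          then have "w \<in> threatened (r t)"
            using w(1) i(1) by (auto simp: threatened_def in_config_iff)
          then have "(?c', y) \<in> parcs G" if "y \<in> Q" "y \<noteq> w"
            using good w that unfolding good_target_def can_move_def by blast
          moreover have "(?c', v) \<in> parcs G"
            using \<open>?c' \<in> Q\<close> leaf_center by simp
          ultimately show ?thesis
            using True w z by (auto simp: new_lost)
        next
          case False
          moreover have "w \<noteq> v"
            using robber_apart_from_cop[OF i(1), of t] w(1) open_play by auto
          ultimately show ?thesis
            using w z by (auto simp: new_lost)
        qed
        have "lost (Suc t) \<subseteq> {if w \<in> Q then w else y}"
          using w(1) robber_apart_from_cop[OF i(1), of t] open_play by (auto simp: new_lost)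
        with safe i gone Some show ?thesis
          unfolding contained_def by (intro disjI2 exI[of _ i]) auto
      qed
    qed
  next
    case contained
    then obtain i w where i: "i < 2" and w: "lost t \<subseteq> {w}" and gone: "r t ! (1 - i) = None"
      and chase: "?c = v \<or> (\<forall>y. r t ! i = Some y \<longrightarrow>
            y \<in> insert v Q \<and> (?c, y) \<in> parcs G \<or> insert y (lost t) \<inter> insert v Q \<subseteq> {w})"
      unfolding contained_def by blast
    have only: "k = i" if "k < 2" "r t ! k = Some y" for k y
      using that i gone by (cases "k = 1 - i") auto
    have gone': "r (Suc t) ! (1 - i) = None"
      using turn[of "1 - i" t] gone i by (simp add: robber_turn_def)
    have lost': "lost (Suc t) =
        lost t \<union> {y \<in> insert v Q. r t ! i = Some y \<and> r (Suc t) ! i \<noteq> None}"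
      using only i by (auto simp: lost_Suc)
    \<comment> \<open>Capturing the last robber adds no damage, and \<open>contained\<close> then
      holds wherever the cop stands.\<close>
    have over: "contained (Suc t)" if "Some ?c' \<in> set (r t)"
    proof -
      have "r t ! i = Some ?c'"
        using that only by (auto simp: in_config_iff)
      with captured i have "r (Suc t) ! i = None" by blast
      with i w gone' show ?thesis
        unfolding contained_def lost' by (intro exI[of _ i]) auto
    qed
    have return: "contained (Suc t)" if "?c' = v" "lost (Suc t) \<subseteq> {z}" for z
      using that i gone' unfolding contained_def by blast
    show ?thesis
    proof (cases "?c = v")
      case True
      show ?thesis
      proof (cases "threatened (r t) = {}")
        case True
        with waits \<open>?c = v\<close> return w show ?thesis by metis
      next
        case False
        with attacks \<open>?c = v\<close> over show ?thesis
          by (auto simp: good_target_def threatened_def)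
      qed
    next
      case False
      show ?thesis
      proof (cases "\<exists>y\<in>insert v Q. Some y \<in> set (r t) \<and> (?c, y) \<in> parcs G")
        case True
        with cop_step_chases(2)[OF False] over show ?thesis
          by (auto simp: c')
      next
        case no_prey: False
        then have "?c' = v"
          unfolding c' using cop_step_returns[OF False] by blast
        \<comment> \<open>Without prey in reach, only the second alternative of \<open>chase\<close>
          is left: the trip back to \<open>v\<close> costs at most \<open>w\<close>.\<close>
        moreover have "insert y (lost t) \<inter> insert v Q \<subseteq> {w}" if "r t ! i = Some y" for y
          using chase False no_prey that i by (auto simp: in_config_iff)
        then have "lost (Suc t) \<subseteq> {w}"
          using w by (auto simp: lost')
        ultimately show ?thesis
          using return by blast
      qed
    qed
  qed
  with in_star show ?case by blast
qed

lemma lost_unique: "y \<in> lost t \<Longrightarrow> z \<in> lost t \<Longrightarrow> y = z"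
  using invariant[of t] by (auto simp: contained_def)

section \<open>Counting the damaged vertices\<close>

lemma card_damaged: "card (damaged 2 r) \<le> card (pverts G) - 3"
proof -
  let ?P = "insert v Q"
  have fin: "finite Q"
    using card_leaves by (simp add: card_ge_0_finite)
  have "\<exists>t. y \<in> lost t" if "y \<in> damaged 2 r \<inter> ?P" for y
    using that by (fastforce simp: damaged_def lost_def)
  \<comment> \<open>By monotonicity, the later of the two rounds has both vertices in its
    \<open>lost\<close> set, so the bound for single rounds carries over to the whole play.\<close>
  then have "y = z" if "y \<in> damaged 2 r \<inter> ?P" "z \<in> damaged 2 r \<inter> ?P" for y z
    using that lost_unique lost_mono by (metis nle_le subsetD)
  then have "card (damaged 2 r \<inter> ?P) \<le> 1"
    using fin by (simp add: card_le_Suc0_iff_eq)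
  moreover have "damaged 2 r \<subseteq> pverts G"
    using robber_in_verts by (auto simp: damaged_def)
  then have "card (damaged 2 r - ?P) \<le> card (pverts G - ?P)"
    by (intro card_mono) auto
  moreover have "card (pverts G - ?P) = card (pverts G) - 4"
    using star_subset fin center_notin_leaves card_leaves by (simp add: card_Diff_subset)
  \<comment> \<open>With at least four vertices, no subtraction is truncated, and 1 + (n - 4) = n -
    3.\<close>
  moreover have "card ?P \<le> card (pverts G)"
    using star_subset by (intro card_mono) auto
  moreover have "card ?P = 4"
    using fin center_notin_leaves card_leaves by simp
  moreover have "card (damaged 2 r) = card (damaged 2 r \<inter> ?P) + card (damaged 2 r - ?P)"
    using \<open>damaged 2 r \<subseteq> pverts G\<close> finite_subset[of _ "pverts G"]
    by (intro card_Int_Diff) auto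
  ultimately show ?thesis by linarith
qed

end

section \<open>The bound on the damage number\<close>

context guarded_star
begin

lemma guarded_star_playI: "robbers_play G 2 guard r \<Longrightarrow> guarded_star_play G v Q r"
  by unfold_locales

lemma legal_guard: "legal_cop_strategy G 2 guard"
  unfolding legal_cop_strategy_def
proof (intro conjI allI impI)
  show "guard [] \<in> pverts G"
    by (simp add: guard_def center)
next
  fix r t
  assume "robbers_play G 2 guard r"
  then interpret guarded_star_play G v Q r
    by (rule guarded_star_playI)
  show "can_move G (cop_pos guard r t) (cop_pos guard r (Suc t))"
    using invariant[of t] length_config cop_step_legal(2) by (simp add: cop_pos_guard_Suc)
qed

lemma dmg_le: "dmg G 2 \<le> card (pverts G) - 3"
  unfolding dmg_def
  using legal_guard guarded_star_play.card_damaged[OF guarded_star_playI]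
  by (intro Least_le exI[of _ guard]) blast

end

theorem proposition2p7:
  fixes G :: "'a pair_pre_digraph" and n :: nat
  assumes "pair_graph G"
    and "card (pverts G) = n"
    and "max_degree G \<ge> 3"
  shows "dmg G 2 \<le> n - 3"
proof -
  interpret pair_graph G by fact
  obtain v where v: "v \<in> pverts G" "3 \<le> card {w. (v, w) \<in> parcs G}"
    using max_degree_attained[of G 3] assms(3) by (auto simp: out_degree_with_proj)
  \<comment> \<open>Keeping exactly three neighbours ensures that two threatened leaves leave only
    one other leaf.\<close>
  then obtain Q where "Q \<subseteq> {w. (v, w) \<in> parcs G}" "card Q = 3"
    by (meson obtain_subset_with_card_n)
  with v interpret guarded_star G v Q
    by unfold_locales auto
  show ?thesis
    using dmg_le assms(2) by simp
qed

end
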